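(* Let $\Omega>0$, let $s\in\mathbf{R}$ and $q\in[-\infty,s)$, and let $N$ be a non-negative integer or $N=+\infty$. For any $x\in\mathcal{X}_{\Omega,N}$ there exists a unique $X\in\mathcal{U}_{\Omega,N}$ such that $x(t)=(\mathcal{F}^{-1}X)(t)$ for (almost every) $t\in(q,s)$.
   Context: All functions are complex valued; $L_2(D)$ is the usual Hilbert space of complex valued square integrable functions on $D$. The Fourier transform of $x\in L_2(\mathbf{R})$ is $X(i\omega)=(\mathcal{F}x)(i\omega)=\int_{-\infty}^{\infty}e^{-i\omega t}x(t)\,dt$, $\omega\in\mathbf{R}$, regarded as an element $X(i\cdot)$ of $L_2(\mathbf{R})$; $\mathcal{F}^{-1}$ is the inverse transform, $(\mathcal{F}^{-1}X)(t)=\frac1{2\pi}\int_{-\infty}^{\infty} X(i\omega)e^{i\omega t}\,d\omega$. $\mathcal{U}_{\Omega,\infty}$ is the set of all $X(i\cdot)\in L_2$ with $X(i\omega)=0$ for $|\omega|>\Omega$. For an integer $N\ge 0$, $\mathcal{U}_{\Omega,N}$ is the set of all $X\in\mathcal{U}_{\Omega,\infty}$ for which there exist complex numbers $\{y_k\}_{k=-N}^N$ with $X(i\omega)=\sum_{k=-N}^N y_k e^{ik\omega\pi/\Omega}\mathbb{I}_{\{|\omega|\le\Omega\}}$, where $\mathbb{I}$ is the indicator function. Elements of $\mathcal{U}_{\Omega,N}$ are identified up to almost everywhere equality. $\mathcal{X}_{\Omega,N}$ is the subset of $L_2(q,s)$ consisting of the restrictions to $(q,s)$ (here $q=-\infty$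 is allowed) of the functions $\mathcal{F}^{-1}X$ with $X\in\mathcal{U}_{\Omega,N}$. *)

theory Defs
  imports "HOL-Analysis.Analysis" "HOL-Library.Extended_Nat"
begin

(* Elements of L2(D) are represented by functions on the reals; two representatives denote
   the same element iff they agree almost everywhere on D. All sets of functions below that
   stand for subsets of an L2 space are closed under this identification. *)
definition L2 :: "real set \<Rightarrow> (real \<Rightarrow> complex) set" where
  "L2 D = {f \<in> borel_measurable (lebesgue_on D). integrable (lebesgue_on D) (\<lambda>t. (cmod (f t))\<^sup>2)}"

(* A transform X(i.) on the imaginary axis is represented by the function mapping the
   frequency w to X(iw). *)
definition band_limited :: "real \<Rightarrow> (real \<Rightarrow> complex) set" where
  "band_limited \<Omega> = {X \<in> L2 UNIV. AE \<omega> in lebesgue. \<bar>\<omega>\<bar> > \<Omega> \<longrightarrow> X \<omega> = 0}"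

definition \<U> :: "real \<Rightarrow> enat \<Rightarrow> (real \<Rightarrow> complex) set" where
  "\<U> \<Omega> N = (case N of
      enat n \<Rightarrow> {X \<in> band_limited \<Omega>. \<exists>y :: int \<Rightarrow> complex. AE \<omega> in lebesgue.
                   X \<omega> = (\<Sum>k = - int n..int n.
                            y k * exp (\<i> * of_int k * of_real \<omega> * of_real pi / of_real \<Omega>)
                              * indicator {\<omega>. \<bar>\<omega>\<bar> \<le> \<Omega>} \<omega>)}
    | \<infinity> \<Rightarrow> band_limited \<Omega>)"

(* The Lebesgue integral agrees with the inverse Fourier transform on L2 only for integrable
   X. This covers all band-limited X, see integrable_band_limited below. *)
definition inverse_fourier :: "(real \<Rightarrow> complex) \<Rightarrow> real \<Rightarrow> complex" where
  "inverse_fourier X t =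
     1 / (2 * of_real pi) * (LINT \<omega>|lebesgue. X \<omega> * exp (\<i> * of_real \<omega> * of_real t))"

lemma integrable_band_limited:
  assumes "X \<in> band_limited \<Omega>"
  shows "integrable lebesgue X"
    and "integrable lebesgue (\<lambda>\<omega>. X \<omega> * exp (\<i> * of_real \<omega> * of_real t))"
proof -
  have meas: "X \<in> borel_measurable lebesgue"
    and sq: "integrable lebesgue (\<lambda>\<omega>. (cmod (X \<omega>))\<^sup>2)"
    and ae: "AE \<omega> in lebesgue. \<bar>\<omega>\<bar> > \<Omega> \<longrightarrow> X \<omega> = 0"
    using assms by (auto simp: band_limited_def L2_def lebesgue_on_UNIV_eq)
  have "integrable lebesgue (indicator {-\<Omega>..\<Omega>} :: real \<Rightarrow> real)"
    by (rule integrable_real_indicator) (auto simp: emeasure_lborel_Icc_eq)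
  then have bound: "integrable lebesgue (\<lambda>\<omega>. indicator {-\<Omega>..\<Omega>} \<omega> + (cmod (X \<omega>))\<^sup>2)"
    using sq by (rule Bochner_Integration.integrable_add)
  have le: "AE \<omega> in lebesgue. cmod (X \<omega>) \<le> indicator {-\<Omega>..\<Omega>} \<omega> + (cmod (X \<omega>))\<^sup>2"
    using ae
  proof eventually_elim
    case (elim \<omega>)
    have "c \<le> 1 + c\<^sup>2" for c :: real
      using sum_power2_ge_zero[of "c - 1" c] zero_le_power2[of "c - 1/2"]
      by (simp add: power2_eq_square algebra_simps)
    then show ?case
      using elim by (cases "\<bar>\<omega>\<bar> > \<Omega>") (auto simp: indicator_def)
  qed
  show "integrable lebesgue X"
    by (rule Bochner_Integration.integrable_bound[OF bound meas])
       (use le in eventually_elim, auto)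
  have "(\<lambda>\<omega>. exp (\<i> * of_real \<omega> * of_real t)) \<in> borel_measurable borel"
    by (intro borel_measurable_continuous_onI continuous_intros)
  then have "(\<lambda>\<omega>. exp (\<i> * of_real \<omega> * of_real t)) \<in> borel_measurable lebesgue"
    by (simp add: measurable_completion)
  with meas have meas': "(\<lambda>\<omega>. X \<omega> * exp (\<i> * of_real \<omega> * of_real t)) \<in> borel_measurable lebesgue"
    by measurable
  show "integrable lebesgue (\<lambda>\<omega>. X \<omega> * exp (\<i> * of_real \<omega> * of_real t))"
    by (rule Bochner_Integration.integrable_bound[OF bound meas'])
       (use le in eventually_elim, auto simp: norm_mult norm_exp_eq_Re)
qed

definition \<X> :: "real \<Rightarrow> enat \<Rightarrow> ereal \<Rightarrow> real \<Rightarrow> (real \<Rightarrow> complex) set" where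
  "\<X> \<Omega> N q s = {x \<in> L2 (einterval q (ereal s)). \<exists>X \<in> \<U> \<Omega> N.
     AE t in lebesgue_on (einterval q (ereal s)). x t = inverse_fourier X t}"

end

theory Submission
  imports Defs "HOL-Complex_Analysis.Cauchy_Integral_Formula"
begin

text \<open>
  Existence is the definition of \<open>\<X> \<Omega> N q s\<close>; the content is uniqueness. All the spaces
  \<open>\<U> \<Omega> N\<close> lie in \<^const>\<open>band_limited\<close>, so it suffices to show that a band-limited function is
  determined almost everywhere by its inverse Fourier transform on a bounded interval \<open>(a, s)\<close>
  (\<open>inverse_fourier_AE_zero_on_interval_imp_AE_0\<close>, applied to the difference of two candidates).

  The inverse transform of a function \<open>D\<close> with bounded support extends to an entire function,
  whose Taylor coefficients at a real point \<open>c\<close> are, up to nonzero factors, the moments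
  \<open>\<integral> h(\<omega>) \<omega>^n d\<omega>\<close> of \<open>h(\<omega>) = D(\<omega>) exp(i \<omega> c)\<close> (\<open>fourier_integral_power_series\<close>). A power series that
  vanishes almost everywhere on an interval about its centre is zero, since the zeros of a
  nonzero one are isolated. Taking for \<open>c\<close> the midpoint of \<open>(a, s)\<close>, all moments of \<open>h\<close>
  vanish. By the Weierstrass approximation theorem, \<open>h\<close> then integrates to zero
  against every continuous function
  (\<open>vanishing_moments_imp_integral_continuous_eq_0\<close>), which forces \<open>h = 0\<close>
  (\<open>vanishing_continuous_integrals_imp_AE_0\<close>), and hence \<open>D = 0\<close>, almost everywhere. Working with
  moments at \<open>c\<close> replaces both the continuation of the zero set to the whole line and the
  injectivity of the Fourier transform.
\<close>

section \<open>Moments of integrable functions with bounded support\<close>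

lemma integrable_mult_continuous_of_bounded_support:
  fixes h g :: "real \<Rightarrow> complex"
  assumes h: "integrable lebesgue h" and supp: "AE \<omega> in lebesgue. \<bar>\<omega>\<bar> > \<Omega> \<longrightarrow> h \<omega> = 0"
    and g: "continuous_on UNIV g"
  shows "integrable lebesgue (\<lambda>\<omega>. h \<omega> * g \<omega>)"
proof -
  have "compact (g ` {-\<Omega>..\<Omega>})"
    by (intro compact_continuous_image continuous_on_subset[OF g]) auto
  then obtain B where B: "\<And>\<omega>. \<omega> \<in> {-\<Omega>..\<Omega>} \<Longrightarrow> cmod (g \<omega>) \<le> B"
    using compact_imp_bounded bounded_iff by (metis imageI)
  have bound: "integrable lebesgue (\<lambda>\<omega>. B * cmod (h \<omega>))"
    using h by auto
  have "g \<in> borel_measurable lebesgue"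
    using g by (simp add: borel_measurable_continuous_onI measurable_completion)
  with h have meas: "(\<lambda>\<omega>. h \<omega> * g \<omega>) \<in> borel_measurable lebesgue"
    by measurable
  show ?thesis
  proof (rule Bochner_Integration.integrable_bound[OF bound meas])
    show "AE \<omega> in lebesgue. cmod (h \<omega> * g \<omega>) \<le> norm (B * cmod (h \<omega>))"
      using supp
    proof eventually_elim
      case (elim \<omega>)
      show ?case
      proof (cases "\<bar>\<omega>\<bar> > \<Omega>")
        case False
        then have "cmod (g \<omega>) \<le> B"
          by (intro B) auto
        then have "cmod (g \<omega>) \<le> \<bar>B\<bar>"
          by linarith
        from mult_left_mono[OF this norm_ge_zero[of "h \<omega>"]] show ?thesis
          by (simp add: norm_mult abs_mult mult.commute)
      qed (use elim in simp)
    qed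
  qed
qed

lemma vanishing_moments_imp_integral_real_polynomial_eq_0:
  fixes h :: "real \<Rightarrow> complex"
  assumes h: "integrable lebesgue h" and supp: "AE \<omega> in lebesgue. \<bar>\<omega>\<bar> > \<Omega> \<longrightarrow> h \<omega> = 0"
    and moments: "\<And>n. (LINT \<omega>|lebesgue. h \<omega> * of_real \<omega> ^ n) = 0"
    and p: "real_polynomial_function p"
  shows "(LINT \<omega>|lebesgue. h \<omega> * of_real (p \<omega>)) = 0"
proof -
  obtain a n where p_eq: "p = (\<lambda>\<omega>. \<Sum>i\<le>n. a i * \<omega> ^ i)"
    using real_polynomial_function_imp_sum[OF p] by blast
  have "(LINT \<omega>|lebesgue. h \<omega> * of_real (p \<omega>)) =
        (LINT \<omega>|lebesgue. (\<Sum>i\<le>n. of_real (a i) * (h \<omega> * of_real \<omega> ^ i)))"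
    by (simp add: p_eq sum_distrib_left mult_ac)
  also have "\<dots> = (\<Sum>i\<le>n. LINT \<omega>|lebesgue. of_real (a i) * (h \<omega> * of_real \<omega> ^ i))"
    by (intro Bochner_Integration.integral_sum integrable_mult_right
          integrable_mult_continuous_of_bounded_support[OF h supp] continuous_intros)
  also have "\<dots> = 0"
    by (simp add: moments)
  finally show ?thesis .
qed

text \<open>
  A continuous \<open>g\<close> is uniformly close to a polynomial on the compact interval that carries \<open>h\<close>, and
  replacing \<open>g\<close> by that polynomial changes the integral by at most the uniform error times
  the \<open>L\<^sup>1\<close> norm of \<open>h\<close>. The approximation theorem is applied to the real and imaginary parts, so the
  error for \<open>g\<close> is at most twice theirs.
\<close>

lemma vanishing_moments_imp_integral_continuous_eq_0:
  fixes h g :: "real \<Rightarrow> complex"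
  assumes h: "integrable lebesgue h" and supp: "AE \<omega> in lebesgue. \<bar>\<omega>\<bar> > \<Omega> \<longrightarrow> h \<omega> = 0"
    and moments: "\<And>n. (LINT \<omega>|lebesgue. h \<omega> * of_real \<omega> ^ n) = 0"
    and g: "continuous_on UNIV g"
  shows "(LINT \<omega>|lebesgue. h \<omega> * g \<omega>) = 0"
proof -
  define C where "C = (LINT \<omega>|lebesgue. cmod (h \<omega>))"
  have "cmod (LINT \<omega>|lebesgue. h \<omega> * g \<omega>) \<le> 2 * e * C" if e: "e > 0" for e
  proof -
    have cont: "continuous_on {-\<Omega>..\<Omega>} (\<lambda>\<omega>. Re (g \<omega>))" "continuous_on {-\<Omega>..\<Omega>} (\<lambda>\<omega>. Im (g \<omega>))"
      by (intro continuous_intros continuous_on_subset[OF g]; simp)+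
    obtain p where p: "real_polynomial_function p"
      and pe: "\<And>\<omega>. \<omega> \<in> {-\<Omega>..\<Omega>} \<Longrightarrow> \<bar>Re (g \<omega>) - p \<omega>\<bar> < e"
      using Stone_Weierstrass_real_polynomial_function[OF _ cont(1) e] by blast
    obtain q where q: "real_polynomial_function q"
      and qe: "\<And>\<omega>. \<omega> \<in> {-\<Omega>..\<Omega>} \<Longrightarrow> \<bar>Im (g \<omega>) - q \<omega>\<bar> < e"
      using Stone_Weierstrass_real_polynomial_function[OF _ cont(2) e] by blast
    have cpq: "continuous_on UNIV p" "continuous_on UNIV q"
      using p q continuous_on_polymonial_function real_polynomial_function_eq by blast+
    note int = integrable_mult_continuous_of_bounded_support[OF h supp]
    have ip: "integrable lebesgue (\<lambda>\<omega>. h \<omega> * of_real (p \<omega>))"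
      and iq: "integrable lebesgue (\<lambda>\<omega>. h \<omega> * of_real (q \<omega>))"
      by (intro int continuous_intros cpq)+
    have i3: "integrable lebesgue (\<lambda>\<omega>. h \<omega> * (g \<omega> - Complex (p \<omega>) (q \<omega>)))"
      unfolding Complex_eq by (intro int continuous_intros cpq g)
    have "(LINT \<omega>|lebesgue. h \<omega> * g \<omega>) =
          (LINT \<omega>|lebesgue. h \<omega> * (g \<omega> - Complex (p \<omega>) (q \<omega>))
             + (h \<omega> * of_real (p \<omega>) + \<i> * (h \<omega> * of_real (q \<omega>))))"
      by (simp add: Complex_eq algebra_simps)
    also have "\<dots> = (LINT \<omega>|lebesgue. h \<omega> * (g \<omega> - Complex (p \<omega>) (q \<omega>)))"
      using i3 ip iq vanishing_moments_imp_integral_real_polynomial_eq_0[OF h supp moments p]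
        vanishing_moments_imp_integral_real_polynomial_eq_0[OF h supp moments q]
      by simp
    also have "cmod \<dots> \<le> (LINT \<omega>|lebesgue. cmod (h \<omega> * (g \<omega> - Complex (p \<omega>) (q \<omega>))))"
      by (rule integral_norm_bound)
    also have "\<dots> \<le> (LINT \<omega>|lebesgue. 2 * e * cmod (h \<omega>))"
    proof (rule integral_mono_AE)
      show "AE \<omega> in lebesgue. cmod (h \<omega> * (g \<omega> - Complex (p \<omega>) (q \<omega>))) \<le> 2 * e * cmod (h \<omega>)"
        using supp
      proof eventually_elim
        case (elim \<omega>)
        show ?case
        proof (cases "\<bar>\<omega>\<bar> > \<Omega>")
          case False
          then have "\<omega> \<in> {-\<Omega>..\<Omega>}" by auto
          then have "cmod (g \<omega> - Complex (p \<omega>) (q \<omega>)) \<le> 2 * e"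
            using cmod_le[of "g \<omega> - Complex (p \<omega>) (q \<omega>)"] pe[of \<omega>] qe[of \<omega>] by simp
          from mult_left_mono[OF this norm_ge_zero[of "h \<omega>"]] show ?thesis
            by (simp add: norm_mult mult_ac)
        qed (use elim in simp)
      qed
    qed (use h i3 in auto)
    also have "\<dots> = 2 * e * C"
      by (simp add: C_def)
    finally show ?thesis .
  qed
  note bound = this
  have C: "C \<ge> 0"
    by (simp add: C_def)
  have "cmod (LINT \<omega>|lebesgue. h \<omega> * g \<omega>) \<le> 0 + e" if "e > 0" for e
  proof -
    have "cmod (LINT \<omega>|lebesgue. h \<omega> * g \<omega>) \<le> 2 * (e / (2 * (C + 1))) * C"
      by (rule bound) (use C that in simp)
    also have "\<dots> \<le> e"
      using C that by (simp add: field_simps)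
    finally show ?thesis by simp
  qed
  then have "cmod (LINT \<omega>|lebesgue. h \<omega> * g \<omega>) \<le> 0"
    by (rule field_le_epsilon)
  then show ?thesis by simp
qed

text \<open>
  Testing \<open>h\<close> against \<open>\<sigma> = cnj (sgn h)\<close> would give its \<open>L\<^sup>1\<close> norm. Although \<open>\<sigma>\<close> is only measurable, it
  is an almost everywhere limit of continuous functions, and because \<open>|\<sigma>| \<le> 1\<close> these may be
  retracted to the unit disc without changing the limit. Dominated convergence with majorant \<open>|h|\<close>
  then applies.
\<close>

lemma vanishing_continuous_integrals_imp_AE_0:
  fixes h :: "real \<Rightarrow> complex"
  assumes h: "integrable lebesgue h"
    and orth: "\<And>g. continuous_on UNIV g \<Longrightarrow> (LINT \<omega>|lebesgue. h \<omega> * g \<omega>) = 0"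
  shows "AE \<omega> in lebesgue. h \<omega> = 0"
proof -
  define \<sigma> where "\<sigma> \<omega> = cnj (sgn (h \<omega>))" for \<omega>
  have hm [measurable]: "h \<in> borel_measurable lebesgue"
    using h by simp
  have \<sigma>m [measurable]: "\<sigma> \<in> borel_measurable lebesgue"
    unfolding \<sigma>_def[abs_def] sgn_div_norm
    by (intro borel_measurable_continuous_on[of cnj] continuous_intros) measurable
  have "\<sigma> measurable_on UNIV"
    by (rule lebesgue_measurable_imp_measurable_on) auto
  then obtain N g where N: "negligible N" and g: "\<And>n. continuous_on UNIV (g n)"
    and lim: "\<And>\<omega>. \<omega> \<notin> N \<Longrightarrow> (\<lambda>n. g n \<omega>) \<longlonglongrightarrow> \<sigma> \<omega>"
    unfolding measurable_on_def by auto
  \<comment> \<open>Composition with the radial retraction onto the closed unit disc.\<close>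
  define k where "k n \<omega> = g n \<omega> / of_real (max 1 (cmod (g n \<omega>)))" for n :: nat and \<omega>
  have k: "continuous_on UNIV (k n)" for n
    unfolding k_def by (intro continuous_intros g) (auto simp: max_def)
  have k1: "cmod (k n \<omega>) \<le> 1" for n \<omega>
    by (auto simp: k_def norm_divide max_def)
  have km [measurable]: "k n \<in> borel_measurable lebesgue" for n
    using k by (simp add: borel_measurable_continuous_onI measurable_completion)
  have klim: "(\<lambda>n. k n \<omega>) \<longlonglongrightarrow> \<sigma> \<omega>" if "\<omega> \<notin> N" for \<omega>
  proof -
    have "cmod (\<sigma> \<omega>) \<le> 1"
      by (simp add: \<sigma>_def norm_sgn)
    then have "max 1 (cmod (\<sigma> \<omega>)) = 1"
      by simp
    moreover have "(\<lambda>n. k n \<omega>) \<longlonglongrightarrow> \<sigma> \<omega> / of_real (max 1 (cmod (\<sigma> \<omega>)))"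
      unfolding k_def by (intro tendsto_intros lim that) (auto simp: max_def)
    ultimately show ?thesis by simp
  qed
  have AEN: "AE \<omega> in lebesgue. \<omega> \<notin> N"
    using N by (simp add: AE_not_in negligible_iff_null_sets)
  have "(\<lambda>n. LINT \<omega>|lebesgue. h \<omega> * k n \<omega>) \<longlonglongrightarrow> (LINT \<omega>|lebesgue. h \<omega> * \<sigma> \<omega>)"
  proof (rule integral_dominated_convergence[where w = "\<lambda>\<omega>. cmod (h \<omega>)"])
    show "AE \<omega> in lebesgue. (\<lambda>n. h \<omega> * k n \<omega>) \<longlonglongrightarrow> h \<omega> * \<sigma> \<omega>"
      using AEN by eventually_elim (intro tendsto_intros klim)
    show "AE \<omega> in lebesgue. cmod (h \<omega> * k n \<omega>) \<le> cmod (h \<omega>)" for n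
      using k1 by (intro AE_I2) (simp add: norm_mult mult_left_le)
  qed (use h in auto)
  then have "(LINT \<omega>|lebesgue. h \<omega> * \<sigma> \<omega>) = 0"
    using orth[OF k] LIMSEQ_unique by (auto simp: LIMSEQ_const_iff)
  moreover have "h \<omega> * \<sigma> \<omega> = of_real (cmod (h \<omega>))" for \<omega>
    using complex_norm_square[of "h \<omega>"]
    by (cases "h \<omega> = 0") (auto simp: \<sigma>_def sgn_eq power2_eq_square field_simps)
  ultimately have "(LINT \<omega>|lebesgue. cmod (h \<omega>)) = 0"
    by simp
  then show ?thesis
    using integral_nonneg_eq_0_iff_AE[of lebesgue "\<lambda>\<omega>. cmod (h \<omega>)"] h by simp
qed

section \<open>Analyticity of the inverse Fourier transform\<close>

text \<open>
  The exponential series is integrated term by term. This is legitimate because on the support the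
  \<open>n\<close>-th term is dominated by \<open>|h| r^n / n!\<close> with \<open>r = |\<Omega>| |z|\<close>, whose integrals form a convergent
  series.
\<close>

lemma fourier_integral_power_series:
  fixes h :: "real \<Rightarrow> complex" and z :: complex
  assumes h: "integrable lebesgue h" and supp: "AE \<omega> in lebesgue. \<bar>\<omega>\<bar> > \<Omega> \<longrightarrow> h \<omega> = 0"
  shows "(\<lambda>n. (\<i> ^ n / fact n * (LINT \<omega>|lebesgue. h \<omega> * of_real \<omega> ^ n)) * z ^ n)
           sums (LINT \<omega>|lebesgue. h \<omega> * exp (\<i> * of_real \<omega> * z))"
proof -
  define C where "C = (LINT \<omega>|lebesgue. cmod (h \<omega>))"
  define r where "r = \<bar>\<Omega>\<bar> * cmod z"
  define f where "f n \<omega> = (\<i> ^ n / fact n * z ^ n) * (h \<omega> * of_real \<omega> ^ n)" for n \<omega>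
  have int: "integrable lebesgue (f n)" for n
    unfolding f_def
    by (intro integrable_mult_right integrable_mult_continuous_of_bounded_support[OF h supp]
          continuous_intros)
  have f_eq: "f n \<omega> = h \<omega> * ((\<i> * of_real \<omega> * z) ^ n /\<^sub>R fact n)" for n \<omega>
    by (simp add: f_def scaleR_conv_of_real power_mult_distrib field_simps)
  have sm: "summable (\<lambda>n. cmod (f n \<omega>))" for \<omega>
    unfolding f_eq norm_mult by (intro summable_mult summable_norm_exp)
  have "summable (\<lambda>n. LINT \<omega>|lebesgue. cmod (f n \<omega>))"
  proof (rule summable_comparison_test)
    show "summable (\<lambda>n. C * (r ^ n /\<^sub>R fact n))"
      by (intro summable_mult summable_exp_generic)
    have "norm (LINT \<omega>|lebesgue. cmod (f n \<omega>)) \<le> C * (r ^ n /\<^sub>R fact n)" for n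
    proof -
      have "norm (LINT \<omega>|lebesgue. cmod (f n \<omega>)) = (LINT \<omega>|lebesgue. cmod (f n \<omega>))"
        by simp
      also have "\<dots> \<le> (LINT \<omega>|lebesgue. cmod (h \<omega>) * (r ^ n /\<^sub>R fact n))"
      proof (rule integral_mono_AE)
        show "AE \<omega> in lebesgue. cmod (f n \<omega>) \<le> cmod (h \<omega>) * (r ^ n /\<^sub>R fact n)"
          using supp
        proof eventually_elim
          case (elim \<omega>)
          show ?case
          proof (cases "\<bar>\<omega>\<bar> > \<Omega>")
            case False
            then have "\<bar>\<omega>\<bar> * cmod z \<le> r"
              unfolding r_def by (intro mult_right_mono) auto
            then have "(\<bar>\<omega>\<bar> * cmod z) ^ n \<le> r ^ n"
              by (intro power_mono) auto
            then show ?thesis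
              by (simp add: f_eq norm_mult norm_power divide_right_mono mult_left_mono
                  divide_inverse_commute[symmetric])
          qed (use elim in \<open>simp add: f_eq\<close>)
        qed
      qed (use h int in auto)
      finally show ?thesis
        by (simp add: C_def)
    qed
    then show "\<exists>N. \<forall>n\<ge>N. norm (LINT \<omega>|lebesgue. cmod (f n \<omega>)) \<le> C * (r ^ n /\<^sub>R fact n)"
      by blast
  qed
  then have "(\<lambda>n. LINT \<omega>|lebesgue. f n \<omega>) sums (LINT \<omega>|lebesgue. (\<Sum>n. f n \<omega>))"
    using int sm by (intro sums_integral) auto
  moreover have "(\<Sum>n. f n \<omega>) = h \<omega> * exp (\<i> * of_real \<omega> * z)" for \<omega>
    unfolding f_eq exp_def by (intro suminf_mult summable_exp_generic)
  moreover have "(LINT \<omega>|lebesgue. f n \<omega>) =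
      (\<i> ^ n / fact n * (LINT \<omega>|lebesgue. h \<omega> * of_real \<omega> ^ n)) * z ^ n" for n
    by (simp add: f_def[abs_def])
  ultimately show ?thesis by simp
qed

text \<open>
  Otherwise the sum of the series would be nonzero on a punctured disc about \<open>0\<close>, and this disc meets the
  real interval in a set of positive measure.
\<close>

lemma power_series_AE_zero_on_interval_imp_coeffs_0:
  fixes a :: "nat \<Rightarrow> complex" and G :: "complex \<Rightarrow> complex"
  assumes sums: "\<And>z. (\<lambda>n. a n * z ^ n) sums G z"
    and d: "d > 0"
    and zero: "AE u in lebesgue. u \<in> {-d<..<d} \<longrightarrow> G (of_real u) = 0"
  shows "a n = 0"
proof (rule ccontr)
  assume an: "a n \<noteq> 0"
  \<comment> \<open>The isolated-zeros theorem asks for a function vanishing at the centre, which is not known for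
      \<open>G\<close> yet. It holds for \<open>z * G z\<close>, whose coefficients are those of \<open>G\<close> shifted by one.\<close>
  define b where "b m = (case m of 0 \<Rightarrow> 0 | Suc k \<Rightarrow> a k)" for m
  have b_sums: "(\<lambda>m. b m * (z - 0) ^ m) sums (z * G z)" for z
  proof -
    have "(\<lambda>m. b (Suc m) * z ^ Suc m) sums (z * G z)"
      using sums_mult[OF sums[of z], of z] by (simp add: b_def mult_ac)
    then show ?thesis
      by (subst (asm) sums_Suc_iff) (simp add: b_def)
  qed
  obtain e where e: "e > 0" and nz: "\<And>z. z \<in> cball 0 e - {0} \<Longrightarrow> z * G z \<noteq> 0"
    using powser_0_nonzero[of 1 0 b "\<lambda>z. z * G z" "Suc n"] b_sums an by (auto simp: b_def)
  define c where "c = min d e"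
  have c: "c > 0"
    using d e by (simp add: c_def)
  have "AE u in lebesgue. u \<notin> {0<..<c}"
    using zero
  proof eventually_elim
    case (elim u)
    show ?case
    proof
      assume u: "u \<in> {0<..<c}"
      then have "G (of_real u) = 0"
        using elim by (simp add: c_def)
      moreover have "of_real u * G (of_real u) \<noteq> 0"
        using u by (intro nz) (auto simp: c_def)
      ultimately show False by simp
    qed
  qed
  then have "{0<..<c} \<in> null_sets lebesgue"
    by (subst (asm) AE_iff_null_sets[symmetric]) auto
  then have "negligible {0<..<c}"
    by (simp add: negligible_iff_null_sets)
  then show False
    using open_not_negligible[of "{0<..<c}"] c by auto
qed

section \<open>Band-limited functions and their inverse transforms on an interval\<close>

text \<open>
  The factor \<open>exp(i \<omega> c)\<close> in \<open>h\<close> translates the transform of \<open>D\<close> so that the midpoint \<open>c\<close> of the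
  interval becomes the centre \<open>0\<close> of the power series \<open>G\<close>. As the factor has no zeros, \<open>h = 0\<close>
  gives \<open>D = 0\<close>.
\<close>

lemma inverse_fourier_AE_zero_on_interval_imp_AE_0:
  fixes D :: "real \<Rightarrow> complex"
  assumes D: "integrable lebesgue D" and supp: "AE \<omega> in lebesgue. \<bar>\<omega>\<bar> > \<Omega> \<longrightarrow> D \<omega> = 0"
    and ab: "a < b"
    and zero: "AE t in lebesgue. t \<in> {a<..<b} \<longrightarrow> inverse_fourier D t = 0"
  shows "AE \<omega> in lebesgue. D \<omega> = 0"
proof -
  define c where "c = (a + b) / 2"
  define d where "d = (b - a) / 2"
  have d: "d > 0"
    using ab by (simp add: d_def)
  define h where "h \<omega> = D \<omega> * exp (\<i> * of_real \<omega> * of_real c)" for \<omega>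
  have h: "integrable lebesgue h"
    unfolding h_def
    by (intro integrable_mult_continuous_of_bounded_support[OF D supp] continuous_intros)
  have hsupp: "AE \<omega> in lebesgue. \<bar>\<omega>\<bar> > \<Omega> \<longrightarrow> h \<omega> = 0"
    using supp by eventually_elim (simp add: h_def)
  define G where "G z = (LINT \<omega>|lebesgue. h \<omega> * exp (\<i> * of_real \<omega> * z))" for z
  have G: "G (of_real u) = 2 * of_real pi * inverse_fourier D (c + u)" for u
    by (simp add: G_def h_def inverse_fourier_def distrib_left exp_add mult_ac)
  have "AE u in lebesgue. c + u \<in> {a<..<b} \<longrightarrow> inverse_fourier D (c + u) = 0"
  proof -
    define S where "S = {t. \<not> (t \<in> {a<..<b} \<longrightarrow> inverse_fourier D t = 0)}"
    from zero obtain Z where "Z \<in> null_sets lebesgue" "S \<subseteq> Z"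
      unfolding eventually_ae_filter by (auto simp: S_def)
    then have "negligible S"
      using negligible_iff_null_sets negligible_subset by blast
    then have "(+) (- c) ` S \<in> null_sets lebesgue"
      using negligible_translation[of S "- c"] negligible_iff_null_sets by metis
    moreover have "u \<in> (+) (- c) ` S" if "c + u \<in> S" for u
      using that by (auto intro!: image_eqI[of _ _ "c + u"])
    ultimately show ?thesis
      by (intro AE_I'[of "(+) (- c) ` S"]) (auto simp: S_def)
  qed
  then have Gzero: "AE u in lebesgue. u \<in> {-d<..<d} \<longrightarrow> G (of_real u) = 0"
    by eventually_elim (auto simp: G c_def d_def field_simps)
  have "(\<lambda>n. (\<i> ^ n / fact n * (LINT \<omega>|lebesgue. h \<omega> * of_real \<omega> ^ n)) * z ^ n) sums G z" for z
    unfolding G_def by (rule fourier_integral_power_series[OF h hsupp])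
  from power_series_AE_zero_on_interval_imp_coeffs_0[OF this d Gzero]
  have moments: "(LINT \<omega>|lebesgue. h \<omega> * of_real \<omega> ^ n) = 0" for n
    by simp
  have "AE \<omega> in lebesgue. h \<omega> = 0"
    by (rule vanishing_continuous_integrals_imp_AE_0[OF h
          vanishing_moments_imp_integral_continuous_eq_0[OF h hsupp moments]])
  then show ?thesis
    by eventually_elim (simp add: h_def)
qed

lemma \<U>_subset_band_limited: "\<U> \<Omega> N \<subseteq> band_limited \<Omega>"
  by (cases N) (auto simp: \<U>_def)

lemma inverse_fourier_diff:
  assumes "X \<in> band_limited \<Omega>" and "Y \<in> band_limited \<Omega>"
  shows "inverse_fourier (\<lambda>\<omega>. X \<omega> - Y \<omega>) t = inverse_fourier X t - inverse_fourier Y t"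
  using integrable_band_limited(2)[OF assms(1), of t] integrable_band_limited(2)[OF assms(2), of t]
  by (simp add: inverse_fourier_def left_diff_distrib right_diff_distrib diff_divide_distrib)

lemma band_limited_AE_eq_if_inverse_fourier_AE_eq:
  assumes X: "X \<in> band_limited \<Omega>" and Y: "Y \<in> band_limited \<Omega>" and qs: "q < ereal s"
    and eq: "AE t in lebesgue_on (einterval q (ereal s)). inverse_fourier X t = inverse_fourier Y t"
  shows "AE \<omega> in lebesgue. X \<omega> = Y \<omega>"
proof -
  \<comment> \<open>Since \<open>q\<close> may be \<open>-\<infinity>\<close>, pass to a subinterval with a real left endpoint.\<close>
  obtain a where a: "q < ereal a" "a < s"
    using ereal_dense2[OF qs] by auto
  have "AE \<omega> in lebesgue. X \<omega> - Y \<omega> = 0"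
  proof (rule inverse_fourier_AE_zero_on_interval_imp_AE_0)
    show "integrable lebesgue (\<lambda>\<omega>. X \<omega> - Y \<omega>)"
      using integrable_band_limited(1) X Y by (intro Bochner_Integration.integrable_diff) auto
    have "AE \<omega> in lebesgue. \<bar>\<omega>\<bar> > \<Omega> \<longrightarrow> X \<omega> = 0" "AE \<omega> in lebesgue. \<bar>\<omega>\<bar> > \<Omega> \<longrightarrow> Y \<omega> = 0"
      using X Y by (auto simp: band_limited_def)
    then show "AE \<omega> in lebesgue. \<bar>\<omega>\<bar> > \<Omega> \<longrightarrow> X \<omega> - Y \<omega> = 0"
      by eventually_elim auto
    show "a < s" by fact
    have "AE t in lebesgue. t \<in> einterval q (ereal s) \<longrightarrow> inverse_fourier X t = inverse_fourier Y t"
      using eq by (subst (asm) AE_restrict_space_iff) auto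
    then show "AE t in lebesgue. t \<in> {a<..<s} \<longrightarrow> inverse_fourier (\<lambda>\<omega>. X \<omega> - Y \<omega>) t = 0"
    proof eventually_elim
      case (elim t)
      show ?case
      proof
        assume t: "t \<in> {a<..<s}"
        then have "q < ereal t"
          using a(1) by (auto intro: order.strict_trans)
        with t elim show "inverse_fourier (\<lambda>\<omega>. X \<omega> - Y \<omega>) t = 0"
          by (simp add: einterval_def inverse_fourier_diff[OF X Y])
      qed
    qed
  qed
  then show ?thesis by simp
qed

theorem proposition2p1:
  fixes \<Omega> s :: real and q :: ereal and N :: enat and x :: "real \<Rightarrow> complex"
  assumes "\<Omega> > 0" and "q < ereal s" and "x \<in> \<X> \<Omega> N q s"
  shows "\<exists>X \<in> \<U> \<Omega> N.
           (AE t in lebesgue_on (einterval q (ereal s)). x t = inverse_fourier X t) \<and>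
           (\<forall>Y \<in> \<U> \<Omega> N.
              (AE t in lebesgue_on (einterval q (ereal s)). x t = inverse_fourier Y t) \<longrightarrow>
              (AE \<omega> in lebesgue. Y \<omega> = X \<omega>))"
proof -
  obtain X where X: "X \<in> \<U> \<Omega> N"
    and xX: "AE t in lebesgue_on (einterval q (ereal s)). x t = inverse_fourier X t"
    using assms(3) by (auto simp: \<X>_def)
  have "AE \<omega> in lebesgue. Y \<omega> = X \<omega>"
    if Y: "Y \<in> \<U> \<Omega> N"
      and xY: "AE t in lebesgue_on (einterval q (ereal s)). x t = inverse_fourier Y t" for Y
  proof (rule band_limited_AE_eq_if_inverse_fourier_AE_eq[OF _ _ assms(2)])
    show "Y \<in> band_limited \<Omega>" "X \<in> band_limited \<Omega>"
      using X Y \<U>_subset_band_limited by auto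
    show "AE t in lebesgue_on (einterval q (ereal s)). inverse_fourier Y t = inverse_fourier X t"
      using xX xY by eventually_elim simp
  qed
  with X xX show ?thesis by blast
qed

end
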